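(* Let $O$ be a finite set of indivisible objects and let $n\ge 2$ agents have additive valuations $V_1,\dots,V_n:2^O\to\mathbb{R}_{\ge0}$. Then there is a protocol that partitions all objects, $O=Z_1\,\dot\cup\cdots\dot\cup\,Z_n$, such that $V_i(Z_i)\ge \mathrm{MMS}_i^{1\text{-out-of-}(2n-2)}(O)$ for every agent $i$.
   Context: For an agent $i$ and integers $1\le l\le d$, the $l$-out-of-$d$ maximin share of $i$ from $O$ is $\mathrm{MMS}_i^{l\text{-out-of-}d}(O):=\max_{\mathbf{P}}\min_{Z}V_i(Z)$, where the maximum ranges over all partitions $\mathbf{P}$ of $O$ into $d$ (possibly empty) subsets and the minimum over all unions $Z$ of $l$ distinct subsets of $\mathbf{P}$. The protocol interacts with agents via queries about their own valuations. *)

theory Defs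
  imports "HOL-Analysis.Measure_Space"
begin

definition valuation_on :: "'a set \<Rightarrow> ('a set \<Rightarrow> real) \<Rightarrow> bool" where
  "valuation_on Obj v \<longleftrightarrow> (\<forall>X\<in>Pow Obj. 0 \<le> v X) \<and> Measure_Space.additive (Pow Obj) v"

(* The parts are indexed, since they may be empty; partition_on only admits nonempty parts. *)
definition splits :: "'i set \<Rightarrow> ('i \<Rightarrow> 'a set) \<Rightarrow> 'a set \<Rightarrow> bool" where
  "splits I P Obj \<longleftrightarrow> disjoint_family_on P I \<and> (\<Union>i\<in>I. P i) = Obj"

(* Distinctness of the l chosen parts is distinctness of their indices, so several empty parts
   count separately. *)
definition min_union :: "('a set \<Rightarrow> real) \<Rightarrow> nat \<Rightarrow> nat \<Rightarrow> (nat \<Rightarrow> 'a set) \<Rightarrow> real" where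
  "min_union v l d P = Min {v (\<Union>j\<in>L. P j) | L. L \<subseteq> {1..d} \<and> card L = l}"

(* Meaningful for finite Obj and 1 \<le> l \<le> d; Min and Max are then taken over
   nonempty finite sets. *)
definition MMS :: "('a set \<Rightarrow> real) \<Rightarrow> nat \<Rightarrow> nat \<Rightarrow> 'a set \<Rightarrow> real" where
  "MMS v l d Obj = Max {min_union v l d P | P. splits {1..d} P Obj}"

lemma min_union_set:
  assumes "l \<le> d"
  shows "finite {v (\<Union>j\<in>L. P j) | L. L \<subseteq> {1..d::nat} \<and> card L = l}"
    and "{v (\<Union>j\<in>L. P j) | L. L \<subseteq> {1..d} \<and> card L = l} \<noteq> {}"
proof -
  have eq: "{v (\<Union>j\<in>L. P j) | L. L \<subseteq> {1..d} \<and> card L = l}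
      = (\<lambda>L. v (\<Union>j\<in>L. P j)) ` {L. L \<subseteq> {1..d} \<and> card L = l}" by auto
  show "finite {v (\<Union>j\<in>L. P j) | L. L \<subseteq> {1..d} \<and> card L = l}"
    unfolding eq by (intro finite_imageI) auto
  have "{1..l} \<subseteq> {1..d} \<and> card {1..l} = l" using assms by auto
  then show "{v (\<Union>j\<in>L. P j) | L. L \<subseteq> {1..d} \<and> card L = l} \<noteq> {}" by blast
qed

lemma MMS_set:
  assumes "finite Obj" "1 \<le> d"
  shows "finite {min_union v l d P | P. splits {1..d} P Obj}"
    and "{min_union v l d P | P. splits {1..d} P Obj} \<noteq> {}"
proof -
  have "{min_union v l d P | P. splits {1..d} P Obj}
      \<subseteq> min_union v l d ` ({1..d} \<rightarrow>\<^sub>E Pow Obj)"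
  proof clarify
    fix P :: "nat \<Rightarrow> 'a set" assume P: "splits {1..d} P Obj"
    have "(\<Union>j\<in>L. restrict P {1..d} j) = (\<Union>j\<in>L. P j)" if "L \<subseteq> {1..d}" for L
      using that by (intro SUP_cong) auto
    then have "{v (\<Union>j\<in>L. P j) | L. L \<subseteq> {1..d} \<and> card L = l}
        = {v (\<Union>j\<in>L. restrict P {1..d} j) | L. L \<subseteq> {1..d} \<and> card L = l}"
      by (metis (no_types, lifting))
    then have "min_union v l d P = min_union v l d (restrict P {1..d})"
      by (simp add: min_union_def)
    moreover have "restrict P {1..d} \<in> {1..d} \<rightarrow>\<^sub>E Pow Obj"
      using P by (auto simp: splits_def)
    ultimately show "min_union v l d P \<in> min_union v l d ` ({1..d} \<rightarrow>\<^sub>E Pow Obj)" by blast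
  qed
  then show "finite {min_union v l d P | P. splits {1..d} P Obj}"
    by (rule finite_subset) (use assms in \<open>auto intro!: finite_imageI finite_PiE\<close>)
  have "splits {1..d} (\<lambda>i. if i = 1 then Obj else {}) Obj"
    using assms by (auto simp: splits_def disjoint_family_on_def split: if_splits)
  then show "{min_union v l d P | P. splits {1..d} P Obj} \<noteq> {}" by blast
qed

(* An adaptive protocol is a well-founded tree, so every run ends after finitely many queries.
   Ask i S k asks agent i for the value of the set S and continues with k applied to the reply;
   Allocate Z ends the run and gives Z i to agent i. The valuations enter only through replies. *)
datatype 'a protocol =
    Allocate "nat \<Rightarrow> 'a set"
  | Ask nat "'a set" "real \<Rightarrow> 'a protocol"

primrec protocol_for :: "nat set \<Rightarrow> 'a set \<Rightarrow> 'a protocol \<Rightarrow> bool" where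
  "protocol_for N Obj (Allocate Z) \<longleftrightarrow> True"
| "protocol_for N Obj (Ask i S k) \<longleftrightarrow> i \<in> N \<and> S \<subseteq> Obj \<and> (\<forall>r. protocol_for N Obj (k r))"

(* The allocation reached when every agent i answers truthfully according to V i. *)
primrec outcome :: "(nat \<Rightarrow> 'a set \<Rightarrow> real) \<Rightarrow> 'a protocol \<Rightarrow> (nat \<Rightarrow> 'a set)" where
  "outcome V (Allocate Z) = Z"
| "outcome V (Ask i S k) = outcome V (k (V i S))"

end

theory Submission
  imports Defs
begin

text \<open>A protocol may query every bundle, so it suffices to find a good allocation for known
  valuations. Let \<open>t i\<close> be the share of agent \<open>i\<close>. An object worth at least \<open>t i\<close> to some agent is
  given to that agent; it meets only one part in the partition of any other agent. If no such
  object is left, with \<open>n\<close> agents and \<open>2n - 2 \<ge> n\<close> parts remaining, one agent offers \<open>n\<close> of its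
  parts, and some of them are assigned by an envy-free matching. The \<open>k < n\<close> unmatched agents
  value each of the \<open>n - k\<close> assigned parts below \<open>t i\<close>, hence what remains at
  \<open>(2n - 2 - (n - k)) t i \<ge> (2k - 1) t i\<close> or more. This is enough for bag filling, since a minimal
  bag that satisfies some agent is worth at most \<open>2 t j\<close> to every agent \<open>j\<close>.\<close>

section \<open>Hall's marriage theorem and envy-free matchings\<close>

text \<open>Induction on \<open>I\<close> by the Halmos-Vaughan case split. If a nonempty proper
  subset \<open>J\<close> is tight, it is matched into its own neighbourhood \<open>U\<close> and
  the remaining indices are matched outside \<open>U\<close>. Otherwise every nonempty proper subset
  has a spare neighbour, so one index may take any of its elements.\<close>

lemma hall_marriage:
  assumes "finite I" "\<And>i. i \<in> I \<Longrightarrow> finite (S i)"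
    and "\<And>J. J \<subseteq> I \<Longrightarrow> card J \<le> card (\<Union>(S ` J))"
  shows "\<exists>f. inj_on f I \<and> (\<forall>i\<in>I. f i \<in> S i)"
  using assms
proof (induction I arbitrary: S rule: finite_psubset_induct)
  case (psubset I)
  show ?case
  proof (cases "\<exists>J. J \<noteq> {} \<and> J \<subset> I \<and> card (\<Union>(S ` J)) \<le> card J")
    case True
    then obtain J where J: "J \<noteq> {}" "J \<subset> I" "card (\<Union>(S ` J)) \<le> card J" by blast
    define U where "U = \<Union>(S ` J)"
    have finJ: "finite J" using J(2) psubset.hyps finite_subset by blast
    have finU: "finite U" using finJ J(2) psubset.prems(1) by (auto simp: U_def)
    have "\<exists>f. inj_on f J \<and> (\<forall>i\<in>J. f i \<in> S i)"
    proof (rule psubset.IH[OF J(2)])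
      show "finite (S i)" if "i \<in> J" for i using that J(2) psubset.prems(1) by blast
      show "card L \<le> card (\<Union>(S ` L))" if "L \<subseteq> J" for L
        using that J(2) psubset.prems(2) by blast
    qed
    then obtain f where f: "inj_on f J" "\<And>i. i \<in> J \<Longrightarrow> f i \<in> S i" by blast
    have "\<exists>g. inj_on g (I - J) \<and> (\<forall>i\<in>I - J. g i \<in> S i - U)"
    proof (rule psubset.IH)
      show "I - J \<subset> I" using J(1,2) by blast
      show "finite (S i - U)" if "i \<in> I - J" for i using that psubset.prems(1) by blast
      show "card L \<le> card (\<Union>i\<in>L. S i - U)" if L: "L \<subseteq> I - J" for L
      proof -
        have finL: "finite L" using L psubset.hyps finite_subset by blast
        \<comment> \<open>Hall's condition is applied to the union of \<open>L\<close> and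
          \<open>J\<close>: its neighbourhood splits into \<open>U\<close>, which has at most
          \<open>card J\<close> elements, and what \<open>L\<close> sees outside \<open>U\<close>,
          which must therefore account for \<open>card L\<close>.\<close>
        have "card L + card J = card (L \<union> J)"
          using L finL finJ by (subst card_Un_disjoint) auto
        also have "\<dots> \<le> card (\<Union>(S ` (L \<union> J)))"
          using L J(2) by (intro psubset.prems(2)) auto
        also have "\<Union>(S ` (L \<union> J)) = (\<Union>i\<in>L. S i - U) \<union> U"
          by (auto simp: U_def)
        also have "card \<dots> \<le> card (\<Union>i\<in>L. S i - U) + card U" by (rule card_Un_le)
        finally show ?thesis using J(3) by (simp add: U_def)
      qed
    qed
    then obtain g where g: "inj_on g (I - J)" "\<And>i. i \<in> I - J \<Longrightarrow> g i \<in> S i - U" by blast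
    define h where "h i = (if i \<in> J then f i else g i)" for i
    have fU: "f i \<in> U" if "i \<in> J" for i using f(2)[OF that] that by (auto simp: U_def)
    have "inj_on h I"
    proof (rule inj_onI)
      fix x y assume xy: "x \<in> I" "y \<in> I" "h x = h y"
      show "x = y"
      proof (cases "x \<in> J"; cases "y \<in> J")
        assume "x \<in> J" "y \<in> J"
        then show ?thesis using xy f(1) by (auto simp: h_def dest: inj_onD)
      next
        assume "x \<in> J" "y \<notin> J"
        then show ?thesis using xy fU[of x] g(2)[of y] by (auto simp: h_def)
      next
        assume "x \<notin> J" "y \<in> J"
        then show ?thesis using xy fU[of y] g(2)[of x] by (auto simp: h_def)
      next
        assume "x \<notin> J" "y \<notin> J"
        then show ?thesis using xy g(1) by (auto simp: h_def dest: inj_onD)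
      qed
    qed
    moreover have "\<forall>i\<in>I. h i \<in> S i" using f(2) g(2) by (auto simp: h_def)
    ultimately show ?thesis by blast
  next
    case False
    show ?thesis
    proof (cases "I = {}")
      case True
      then show ?thesis by simp
    next
      case ne: False
      then obtain i where i: "i \<in> I" by blast
      have "S i \<noteq> {}" using psubset.prems(2)[of "{i}"] i by auto
      then obtain a where a: "a \<in> S i" by blast
      have "\<exists>g. inj_on g (I - {i}) \<and> (\<forall>j\<in>I - {i}. g j \<in> S j - {a})"
      proof (rule psubset.IH)
        show "I - {i} \<subset> I" using i by blast
        show "finite (S j - {a})" if "j \<in> I - {i}" for j using that psubset.prems(1) by blast
        show "card L \<le> card (\<Union>j\<in>L. S j - {a})" if L: "L \<subseteq> I - {i}" for L
        proof (cases "L = {}")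
          case True
          then show ?thesis by simp
        next
          case Lne: False
          \<comment> \<open>No nonempty proper subset is tight, so \<open>L\<close> has a surplus of
            at least one neighbour, which pays for deleting \<open>a\<close>.\<close>
          have "L \<subset> I" using L i by blast
          then have "card L < card (\<Union>(S ` L))" using False Lne not_le_imp_less by blast
          also have "\<dots> \<le> card (\<Union>(S ` L) - {a}) + 1"
            by (simp add: card_Diff_singleton_if; linarith)
          also have "\<Union>(S ` L) - {a} = (\<Union>j\<in>L. S j - {a})" by blast
          finally show ?thesis by simp
        qed
      qed
      then obtain g where g: "inj_on g (I - {i})" "\<And>j. j \<in> I - {i} \<Longrightarrow> g j \<in> S j - {a}"
        by blast
      have "inj_on (g(i := a)) I"
      proof (rule inj_onI)
        fix x y assume xy: "x \<in> I" "y \<in> I" "(g(i := a)) x = (g(i := a)) y"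
        then show "x = y"
          using g(2)[of x] g(2)[of y] inj_onD[OF g(1), of x y] by (auto split: if_splits)
      qed
      moreover have "\<forall>j\<in>I. (g(i := a)) j \<in> S j" using a g(2) by auto
      ultimately show ?thesis by blast
    qed
  qed
qed

text \<open>A minimal nonempty set of bags with at most as many neighbours as elements satisfies
  Hall's condition, and its neighbours are then exactly the matched agents.\<close>

lemma envy_free_matching:
  assumes A: "finite A" and B: "finite B" "B \<noteq> {}" "card A \<le> card B"
    and liked: "\<And>b. b \<in> B \<Longrightarrow> \<exists>a\<in>A. likes a b"
  obtains X f where "X \<subseteq> B" "X \<noteq> {}" "inj_on f X" "f ` X \<subseteq> A"
    "\<And>b. b \<in> X \<Longrightarrow> likes (f b) b"
    "\<And>a b. a \<in> A - f ` X \<Longrightarrow> b \<in> X \<Longrightarrow> \<not> likes a b"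
proof -
  define N where "N b = {a \<in> A. likes a b}" for b
  define T where "T X \<longleftrightarrow> X \<subseteq> B \<and> X \<noteq> {} \<and> card (\<Union>(N ` X)) \<le> card X" for X
  have "card (\<Union>(N ` B)) \<le> card A" using A by (intro card_mono) (auto simp: N_def)
  then have "T B" using B by (simp add: T_def)
  then obtain X where X: "T X" and min: "\<And>Y. T Y \<Longrightarrow> card X \<le> card Y"
    using ex_has_least_nat[of T B card] by blast
  have XB: "X \<subseteq> B" "X \<noteq> {}" and tight: "card (\<Union>(N ` X)) \<le> card X" using X by (auto simp: T_def)
  have finX: "finite X" using XB(1) B(1) finite_subset by blast
  have finN: "finite (N b)" for b using A by (simp add: N_def)
  have strict: "card Y < card (\<Union>(N ` Y))" if "Y \<subset> X" "Y \<noteq> {}" for Y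
  proof (rule ccontr)
    assume "\<not> ?thesis"
    then have "T Y" using that XB(1) by (auto simp: T_def)
    then show False using min[of Y] psubset_card_mono[OF finX that(1)] by simp
  qed
  \<comment> \<open>Minimality says nothing about \<open>X\<close> itself. Dropping one bag gives a
    strict inequality that makes up for that bag, unless \<open>X\<close> is a singleton; then it is
    enough that somebody likes its only bag.\<close>
  have full: "card X \<le> card (\<Union>(N ` X))"
  proof -
    obtain b where b: "b \<in> X" using XB(2) by blast
    show ?thesis
    proof (cases "X = {b}")
      case True
      have "N b \<noteq> {}" using liked[of b] b XB(1) by (auto simp: N_def)
      then show ?thesis using True finN[of b] by (simp add: Suc_le_eq card_gt_0_iff)
    next
      case False
      have "card (X - {b}) < card (\<Union>(N ` (X - {b})))"
        using b False by (intro strict) auto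
      also have "\<dots> \<le> card (\<Union>(N ` X))" using finX finN by (intro card_mono) auto
      finally show ?thesis using b finX by simp
    qed
  qed
  have "\<exists>f. inj_on f X \<and> (\<forall>b\<in>X. f b \<in> N b)"
  proof (rule hall_marriage[OF finX finN])
    show "card Y \<le> card (\<Union>(N ` Y))" if "Y \<subseteq> X" for Y
      using that full strict[of Y] by (cases "Y = X"; cases "Y = {}") (auto simp: psubset_eq)
  qed
  then obtain f where f: "inj_on f X" "\<And>b. b \<in> X \<Longrightarrow> f b \<in> N b" by blast
  have "f ` X = \<Union>(N ` X)"
    using f finX finN tight by (intro card_seteq) (auto simp: card_image)
  then have "\<not> likes a b" if "a \<in> A - f ` X" "b \<in> X" for a b
    using that by (auto simp: N_def)
  then show thesis
    using that[OF XB f(1)] f(2) by (auto simp: N_def)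
qed

section \<open>Partial allocations and bag filling\<close>

text \<open>The bundles need not cover \<open>Obj\<close>. Partial allocations on disjoint sets of
  objects can then be glued freely, and leftovers are distributed only at the very end.\<close>

definition allocation ::
  "'i set \<Rightarrow> 'a set \<Rightarrow> ('i \<Rightarrow> 'a \<Rightarrow> real) \<Rightarrow> ('i \<Rightarrow> real) \<Rightarrow> ('i \<Rightarrow> 'a set) \<Rightarrow> bool" where
  "allocation A Obj w t Z \<longleftrightarrow>
    disjoint_family_on Z A \<and> (\<forall>i\<in>A. Z i \<subseteq> Obj \<and> t i \<le> sum (w i) (Z i))"

lemma allocation_combine:
  assumes "allocation A S w t Y" "allocation B (Obj - S) w t Z" "S \<subseteq> Obj"
  shows "allocation (A \<union> B) Obj w t (\<lambda>i. if i \<in> A then Y i else Z i)"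
proof -
  have YZ: "Y i \<inter> Z j = {}" if "i \<in> A" "j \<in> B" for i j
    using assms(1,2) that unfolding allocation_def by blast
  show ?thesis
    unfolding allocation_def
  proof
    show "disjoint_family_on (\<lambda>i. if i \<in> A then Y i else Z i) (A \<union> B)"
      unfolding disjoint_family_on_def
    proof (intro ballI impI)
      fix i j assume "i \<in> A \<union> B" "j \<in> A \<union> B" "i \<noteq> j"
      then show "(if i \<in> A then Y i else Z i) \<inter> (if j \<in> A then Y j else Z j) = {}"
        using YZ[of i j] YZ[of j i] disjoint_family_onD[of Y A i j] disjoint_family_onD[of Z B i j]
          assms(1,2)
        unfolding allocation_def by (auto simp: Int_commute)
    qed
    show "\<forall>i\<in>A \<union> B. (if i \<in> A then Y i else Z i) \<subseteq> Obj \<and>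
        t i \<le> sum (w i) (if i \<in> A then Y i else Z i)"
      using assms by (auto simp: allocation_def)
  qed
qed

lemma allocation_single: "S \<subseteq> Obj \<Longrightarrow> t i \<le> sum (w i) S \<Longrightarrow> allocation {i} Obj w t (\<lambda>_. S)"
  by (simp add: allocation_def disjoint_family_on_def)

lemma allocation_insert:
  assumes "i \<in> A" "S \<subseteq> Obj" "t i \<le> sum (w i) S" "allocation (A - {i}) (Obj - S) w t Z"
  shows "\<exists>Z. allocation A Obj w t Z"
proof -
  have "allocation {i} S w t (\<lambda>_. S)" by (rule allocation_single[OF order_refl, of t i w, OF assms(3)])
  from allocation_combine[OF this assms(4,2)] show ?thesis
    using assms(1) by (auto simp: insert_absorb)
qed

text \<open>Serving one agent lowers the coefficient \<open>2 * card A - 1\<close> by 2 and costs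
  every other agent \<open>k\<close> at most \<open>2 * t k\<close>, so the bound is preserved by
  induction. For a single agent it says that \<open>Obj\<close> itself suffices.\<close>

lemma bag_filling:
  assumes "finite A" "A \<noteq> {}" "finite Obj"
    and "\<And>i. i \<in> A \<Longrightarrow> 0 \<le> t i"
    and "\<And>i x. i \<in> A \<Longrightarrow> x \<in> Obj \<Longrightarrow> 0 \<le> w i x \<and> w i x \<le> t i"
    and "\<And>i. i \<in> A \<Longrightarrow> (2 * real (card A) - 1) * t i \<le> sum (w i) Obj"
  shows "\<exists>Z. allocation A Obj w t Z"
  using assms
proof (induction A arbitrary: Obj rule: finite_psubset_induct)
  case (psubset A)
  define T where "T S \<longleftrightarrow> S \<subseteq> Obj \<and> (\<exists>i\<in>A. t i \<le> sum (w i) S)" for S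
  have "1 \<le> card A" using psubset.hyps psubset.prems(1) by (simp add: Suc_le_eq card_gt_0_iff)
  obtain j where j: "j \<in> A" using psubset.prems(1) by blast
  have "1 * t j \<le> (2 * real (card A) - 1) * t j"
    using \<open>1 \<le> card A\<close> psubset.prems(3)[OF j] by (intro mult_right_mono) auto
  then have "t j \<le> sum (w j) Obj" using psubset.prems(5)[OF j] by simp
  then have "T Obj" using j by (auto simp: T_def)
  then obtain S where S: "T S" and min: "\<And>R. T R \<Longrightarrow> card S \<le> card R"
    using ex_has_least_nat[of T Obj card] by blast
  obtain i where i: "i \<in> A" "t i \<le> sum (w i) S" and SO: "S \<subseteq> Obj"
    using S by (auto simp: T_def)
  have finS: "finite S" using SO psubset.prems(2) finite_subset by blast
  have small: "sum (w k) S \<le> 2 * t k" if k: "k \<in> A" for k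
  \<comment> \<open>The minimal bag is empty when some threshold is 0. Otherwise, removing an object
    \<open>x\<close> leaves a bag that is too small for every agent, and \<open>x\<close> adds at
    most \<open>t k\<close>.\<close>
  proof (cases "S = {}")
    case True
    then show ?thesis using psubset.prems(3)[OF k] by simp
  next
    case False
    then obtain x where x: "x \<in> S" by blast
    have "\<not> T (S - {x})"
      using min[of "S - {x}"] card_Diff1_less[OF finS x] by linarith
    then have "sum (w k) (S - {x}) < t k" using SO k by (auto simp: T_def not_le)
    moreover have "w k x \<le> t k" using psubset.prems(4)[OF k] x SO by blast
    ultimately show ?thesis using sum.remove[OF finS x, of "w k"] by simp
  qed
  show ?case
  proof (cases "A = {i}")
    case True
    then show ?thesis using allocation_single[of S Obj t i w] i SO by blast
  next
    case False
    have "\<exists>Z. allocation (A - {i}) (Obj - S) w t Z"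
    proof (rule psubset.IH)
      show "A - {i} \<subset> A" "A - {i} \<noteq> {}" using i False by auto
      show "finite (Obj - S)" using psubset.prems(2) by blast
      show "0 \<le> t k" if "k \<in> A - {i}" for k using that psubset.prems(3) by blast
      show "0 \<le> w k x \<and> w k x \<le> t k" if "k \<in> A - {i}" "x \<in> Obj - S" for k x
        using that psubset.prems(4) by blast
      show "(2 * real (card (A - {i})) - 1) * t k \<le> sum (w k) (Obj - S)" if "k \<in> A - {i}" for k
      proof -
        have c: "real (card (A - {i})) = real (card A) - 1"
          using i(1) psubset.hyps \<open>1 \<le> card A\<close> by (simp add: of_nat_diff)
        have "(2 * real (card (A - {i})) - 1) * t k = (2 * real (card A) - 1) * t k - 2 * t k"
          unfolding c by (simp add: algebra_simps)
        also have "\<dots> \<le> sum (w k) Obj - sum (w k) S"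
          using psubset.prems(5)[of k] small[of k] that by fastforce
        also have "\<dots> = sum (w k) (Obj - S)"
          using SO psubset.prems(2) by (simp add: sum_diff)
        finally show ?thesis .
      qed
    qed
    then show ?thesis using allocation_insert[of i A S Obj t w] i SO by blast
  qed
qed

section \<open>Disjoint families of sufficiently valuable parts\<close>

text \<open>A weakened form of a maximin partition: the parts need not cover \<open>Obj\<close>, and
  any index set of the right size is allowed, so that parts can be discarded without
  renumbering.\<close>

definition has_parts :: "('a \<Rightarrow> real) \<Rightarrow> real \<Rightarrow> nat \<Rightarrow> 'a set \<Rightarrow> bool" where
  "has_parts u s d Obj \<longleftrightarrow> (\<exists>(K :: nat set) P. finite K \<and> card K = d \<and> disjoint_family_on P K \<and>
    (\<forall>k\<in>K. P k \<subseteq> Obj \<and> s \<le> sum u (P k)))"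

lemma has_parts_mono:
  assumes "has_parts u s d Obj" "e \<le> d"
  shows "has_parts u s e Obj"
proof -
  obtain K :: "nat set" and P where K: "finite K" "card K = d" "disjoint_family_on P K"
    "\<forall>k\<in>K. P k \<subseteq> Obj \<and> s \<le> sum u (P k)"
    using assms(1) unfolding has_parts_def by blast
  obtain L where "L \<subseteq> K" "card L = e" "finite L"
    using obtain_subset_with_card_n[of e K] assms(2) K(2) by blast
  then show ?thesis
    unfolding has_parts_def using K disjoint_family_on_mono[of L K P] by blast
qed

text \<open>Disjointness puts \<open>x\<close> into at most one part. Discarding that part, or an
  arbitrary one if there is none, leaves all others intact.\<close>

lemma has_parts_remove:
  assumes "has_parts u s (Suc d) Obj"
  shows "has_parts u s d (Obj - {x})"
proof -
  obtain K :: "nat set" and P where K: "finite K" "card K = Suc d" "disjoint_family_on P K"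
    "\<forall>k\<in>K. P k \<subseteq> Obj \<and> s \<le> sum u (P k)"
    using assms unfolding has_parts_def by blast
  obtain k where k: "k \<in> K" "\<forall>j\<in>K - {k}. x \<notin> P j"
  proof (cases "\<exists>k\<in>K. x \<in> P k")
    case True
    then show ?thesis using that K(3) unfolding disjoint_family_on_def by blast
  next
    case False
    moreover obtain k where "k \<in> K" using K(2) by fastforce
    ultimately show ?thesis using that by blast
  qed
  show ?thesis unfolding has_parts_def
  proof (intro exI conjI)
    show "finite (K - {k})" "card (K - {k}) = d" using K k by auto
    show "disjoint_family_on P (K - {k})" using K(3) by (rule disjoint_family_on_mono[rotated]) auto
    show "\<forall>j\<in>K - {k}. P j \<subseteq> Obj - {x} \<and> s \<le> sum u (P j)" using K(4) k by blast
  qed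
qed

lemma sum_UN_family:
  assumes "disjoint_family_on P K" "finite K" "finite Obj" "\<And>k. k \<in> K \<Longrightarrow> P k \<subseteq> Obj"
  shows "sum u (\<Union>(P ` K)) = (\<Sum>k\<in>K. sum u (P k))"
proof (rule sum.UNION_disjoint)
  show "\<forall>k\<in>K. finite (P k)" using assms(3,4) finite_subset by blast
qed (use assms(1,2) in \<open>auto simp: disjoint_family_on_def\<close>)

lemma has_parts_sum:
  assumes "has_parts u s d Obj" "finite Obj" "\<And>x. x \<in> Obj \<Longrightarrow> 0 \<le> u x"
  shows "real d * s \<le> sum u Obj"
proof -
  obtain K :: "nat set" and P where K: "finite K" "card K = d" "disjoint_family_on P K"
    "\<forall>k\<in>K. P k \<subseteq> Obj \<and> s \<le> sum u (P k)"
    using assms(1) unfolding has_parts_def by blast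
  have "real d * s \<le> (\<Sum>k\<in>K. sum u (P k))"
    using K sum_bounded_below[of K s "\<lambda>k. sum u (P k)"] by simp
  also have "\<dots> = sum u (\<Union>(P ` K))"
    by (rule sum_UN_family[symmetric, OF K(3,1) assms(2)]) (use K(4) in blast)
  also have "\<dots> \<le> sum u Obj" using K assms by (intro sum_mono2) auto
  finally show ?thesis .
qed

section \<open>Existence of an allocation for thresholds witnessed by parts\<close>

text \<open>The bags are parts of a single agent \<open>c\<close>, who accepts each of them; this
  gives the matching lemma its hypothesis that every bag is liked. Matched agents leave with their
  bags, and bag filling serves the others, in whose eyes these bags were cheap.\<close>

lemma allocation_without_large_objects:
  assumes A: "finite A" "2 \<le> card A" and Obj: "finite Obj"
    and t: "\<And>i. i \<in> A \<Longrightarrow> 0 \<le> t i"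
    and w: "\<And>i x. i \<in> A \<Longrightarrow> x \<in> Obj \<Longrightarrow> 0 \<le> w i x \<and> w i x \<le> t i"
    and parts: "\<And>i. i \<in> A \<Longrightarrow> has_parts (w i) (t i) (2 * card A - 2) Obj"
  shows "\<exists>Z. allocation A Obj w t Z"
proof -
  obtain c where c: "c \<in> A" using A by fastforce
  \<comment> \<open>As many bags as agents are required, and \<open>2 * card A - 2\<close> is at
    least \<open>card A\<close> since there are two or more agents.\<close>
  have "has_parts (w c) (t c) (card A) Obj"
    using parts[OF c] by (rule has_parts_mono) (use A(2) in simp)
  then obtain K :: "nat set" and P where K: "finite K" "card K = card A" "disjoint_family_on P K"
    "\<forall>k\<in>K. P k \<subseteq> Obj \<and> t c \<le> sum (w c) (P k)"
    unfolding has_parts_def by blast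
  have "K \<noteq> {}" using K(2) A(2) by auto
  obtain X f where X: "X \<subseteq> K" "X \<noteq> {}" "inj_on f X" "f ` X \<subseteq> A"
    and likes: "\<And>b. b \<in> X \<Longrightarrow> t (f b) \<le> sum (w (f b)) (P b)"
    and dislikes: "\<And>a b. a \<in> A - f ` X \<Longrightarrow> b \<in> X \<Longrightarrow> \<not> t a \<le> sum (w a) (P b)"
  proof (rule envy_free_matching[of A K "\<lambda>a b. t a \<le> sum (w a) (P b)"])
    show "\<exists>a\<in>A. t a \<le> sum (w a) (P b)" if "b \<in> K" for b using that K(4) c by blast
  qed (use A K \<open>K \<noteq> {}\<close> in auto)
  define S where "S = \<Union>(P ` X)"
  define A' where "A' = A - f ` X"
  have finX: "finite X" using X(1) K(1) finite_subset by blast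
  have SO: "S \<subseteq> Obj" using X(1) K(4) by (auto simp: S_def)
  have disX: "disjoint_family_on P X" using disjoint_family_on_mono[OF X(1) K(3)] .
  \<comment> \<open>\<open>f\<close> sends bags to agents, so its inverse on \<open>X\<close>
    returns the bag of a matched agent.\<close>
  have matched: "allocation (f ` X) S w t (\<lambda>i. P (the_inv_into X f i))"
    unfolding allocation_def
  proof
    show "disjoint_family_on (\<lambda>i. P (the_inv_into X f i)) (f ` X)"
      unfolding disjoint_family_on_def using X(3) disjoint_family_onD[OF disX]
      by (metis imageE the_inv_into_f_f)
    show "\<forall>i\<in>f ` X. P (the_inv_into X f i) \<subseteq> S \<and> t i \<le> sum (w i) (P (the_inv_into X f i))"
      using X(3) likes by (auto simp: S_def the_inv_into_f_f)
  qed
  have "\<exists>Z. allocation A' (Obj - S) w t Z"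
  proof (cases "A' = {}")
    case True
    then show ?thesis by (simp add: allocation_def disjoint_family_on_def)
  next
    case False
    have cards: "card A' + card X = card A" "1 \<le> card X"
      using X A(1) finX card_mono[of A "f ` X"]
      by (auto simp: A'_def card_Diff_subset card_image Suc_le_eq card_gt_0_iff)
    show ?thesis
    proof (rule bag_filling)
      show "finite A'" "A' \<noteq> {}" "finite (Obj - S)" using A Obj False by (auto simp: A'_def)
      show "0 \<le> t i" if "i \<in> A'" for i using that t by (simp add: A'_def)
      show "0 \<le> w i x \<and> w i x \<le> t i" if "i \<in> A'" "x \<in> Obj - S" for i x
        using that w by (simp add: A'_def)
      show "(2 * real (card A') - 1) * t i \<le> sum (w i) (Obj - S)" if i: "i \<in> A'" for i
      proof -
        have iA: "i \<in> A" using i by (simp add: A'_def)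
        have "sum (w i) S = (\<Sum>k\<in>X. sum (w i) (P k))"
          unfolding S_def by (rule sum_UN_family[OF disX finX Obj]) (use X(1) K(4) in blast)
        also have "\<dots> \<le> real (card X) * t i"
          using dislikes[of i] i by (intro sum_bounded_above) (force simp: A'_def)
        finally have S: "sum (w i) S \<le> real (card X) * t i" .
        have "real (2 * card A - 2) * t i \<le> sum (w i) Obj"
          using has_parts_sum[OF parts[OF iA] Obj] w[OF iA] by blast
        \<comment> \<open>Substituting \<open>card A = card A' + card X\<close> turns the right-hand
          coefficient into \<open>2 * card A' + card X - 2\<close>. It is large enough precisely
          because the matching is nonempty.\<close>
        moreover have "(2 * real (card A') - 1) * t i
            \<le> (real (2 * card A - 2) - real (card X)) * t i"
          using cards A(2) t[OF iA] by (intro mult_right_mono) (auto simp: of_nat_diff)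
        ultimately have "(2 * real (card A') - 1) * t i \<le> sum (w i) Obj - sum (w i) S"
          using S by (simp add: left_diff_distrib)
        then show ?thesis using SO Obj by (simp add: sum_diff)
      qed
    qed
  qed
  then obtain Z where Z: "allocation A' (Obj - S) w t Z" by blast
  have "f ` X \<union> A' = A" using X(4) by (auto simp: A'_def)
  then show ?thesis using allocation_combine[OF matched Z SO] by auto
qed

text \<open>Induction on the agents: a large object satisfies one agent and destroys at most one
  part of any other. The \<open>max 1\<close> covers a single agent, for whom
  \<open>2 * card A - 2\<close> would be 0 although one part is required.\<close>

lemma allocation_exists:
  assumes "finite A" "A \<noteq> {}" "finite Obj"
    and "\<And>i. i \<in> A \<Longrightarrow> 0 \<le> t i"
    and "\<And>i x. i \<in> A \<Longrightarrow> x \<in> Obj \<Longrightarrow> 0 \<le> w i x"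
    and "\<And>i. i \<in> A \<Longrightarrow> has_parts (w i) (t i) (max 1 (2 * card A - 2)) Obj"
  shows "\<exists>Z. allocation A Obj w t Z"
  using assms
proof (induction A arbitrary: Obj rule: finite_psubset_induct)
  case (psubset A)
  show ?case
  proof (cases "\<exists>i. A = {i}")
    case True
    then obtain i where i: "A = {i}" by blast
    then have "t i \<le> sum (w i) Obj"
      using has_parts_sum[of "w i" "t i" 1 Obj] psubset.prems by simp
    then show ?thesis using allocation_single[of Obj Obj t i w] i by blast
  next
    case False
    have card: "2 \<le> card A"
    proof -
      have "card A \<noteq> 0" using psubset.hyps psubset.prems(1) by simp
      moreover have "card A \<noteq> 1" using False card_1_singletonE by metis
      ultimately show ?thesis by linarith
    qed
    show ?thesis
    proof (cases "\<exists>i\<in>A. \<exists>x\<in>Obj. t i \<le> w i x")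
      case True
      then obtain i x where ix: "i \<in> A" "x \<in> Obj" "t i \<le> w i x" by blast
      have card': "card (A - {i}) = card A - 1" using ix(1) psubset.hyps by simp
      have "\<exists>Z. allocation (A - {i}) (Obj - {x}) w t Z"
      proof (rule psubset.IH)
        show "A - {i} \<subset> A" "A - {i} \<noteq> {}" using ix(1) False by auto
        show "finite (Obj - {x})" using psubset.prems(2) by blast
        show "0 \<le> t k" if "k \<in> A - {i}" for k using that psubset.prems(3) by blast
        show "0 \<le> w k y" if "k \<in> A - {i}" "y \<in> Obj - {x}" for k y
          using that psubset.prems(4) by blast
        show "has_parts (w k) (t k) (max 1 (2 * card (A - {i}) - 2)) (Obj - {x})"
          if "k \<in> A - {i}" for k
        proof (rule has_parts_remove)
          have "has_parts (w k) (t k) (max 1 (2 * card A - 2)) Obj"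
            using that by (intro psubset.prems(5)) blast
          \<comment> \<open>The number of required parts drops by 2 from three agents on, but only
            by 1, from 2 to 1, when two agents become one. Losing one part to \<open>x\<close> is
            thus affordable in both cases.\<close>
          then show "has_parts (w k) (t k) (Suc (max 1 (2 * card (A - {i}) - 2))) Obj"
            by (rule has_parts_mono) (use card card' in linarith)
        qed
      qed
      then show ?thesis using allocation_insert[of i A "{x}" Obj t w] ix by auto
    next
      case False
      show ?thesis
      proof (rule allocation_without_large_objects[OF psubset.hyps card psubset.prems(2,3)])
        show "0 \<le> w i x \<and> w i x \<le> t i" if "i \<in> A" "x \<in> Obj" for i x
          using that psubset.prems(4) False by force
        show "has_parts (w i) (t i) (2 * card A - 2) Obj" if "i \<in> A" for i
          using has_parts_mono[OF psubset.prems(5)[OF that]] by simp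
      qed
    qed
  qed
qed

section \<open>From additive valuations and maximin shares to parts\<close>

lemma valuation_on_nonneg: "valuation_on Obj v \<Longrightarrow> S \<subseteq> Obj \<Longrightarrow> 0 \<le> v S"
  by (simp add: valuation_on_def)

lemma valuation_on_eq_sum:
  assumes "valuation_on Obj v" "finite Obj" "S \<subseteq> Obj"
  shows "v S = (\<Sum>x\<in>S. v {x})"
proof -
  have add: "v (X \<union> Y) = v X + v Y" if "X \<subseteq> Obj" "Y \<subseteq> Obj" "X \<inter> Y = {}" for X Y
    using assms(1) that by (simp add: valuation_on_def Measure_Space.additive_def)
  have "finite S" using assms finite_subset by blast
  then show ?thesis using assms(3)
  proof (induction S rule: finite_induct)
    case empty
    \<comment> \<open>Additivity on two empty sets gives \<open>v {} = v {} + v {}\<close>, hence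
      \<open>v {} = 0\<close>.\<close>
    then show ?case using add[of "{}" "{}"] by simp
  next
    case (insert x S)
    then show ?case using add[of "{x}" S] by simp
  qed
qed

lemma min_union_1_le:
  assumes "j \<in> {1..d}"
  shows "min_union v 1 d P \<le> v (P j)"
  unfolding min_union_def
proof (rule Min_le)
  show "finite {v (\<Union>j\<in>L. P j) | L. L \<subseteq> {1..d} \<and> card L = 1}"
    using assms by (intro min_union_set) auto
  show "v (P j) \<in> {v (\<Union>j\<in>L. P j) | L. L \<subseteq> {1..d} \<and> card L = 1}"
    using assms by (intro CollectI exI[of _ "{j}"]) auto
qed

lemma MMS_attained:
  assumes "finite Obj" "1 \<le> d"
  obtains P where "splits {1..d} P Obj" "MMS v l d Obj = min_union v l d P"
  using Max_in[OF MMS_set[OF assms, of v l]] unfolding MMS_def by blast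

lemma MMS_nonneg:
  assumes "finite Obj" "1 \<le> d" "l \<le> d" "valuation_on Obj v"
  shows "0 \<le> MMS v l d Obj"
proof -
  obtain P where P: "splits {1..d} P Obj" "MMS v l d Obj = min_union v l d P"
    using MMS_attained[OF assms(1,2)] by blast
  obtain L where L: "L \<subseteq> {1..d}" "min_union v l d P = v (\<Union>j\<in>L. P j)"
    using Min_in[OF min_union_set[OF assms(3), of v P]] unfolding min_union_def by blast
  have "(\<Union>j\<in>L. P j) \<subseteq> Obj" using P(1) L(1) by (auto simp: splits_def)
  then show ?thesis using P(2) L(2) valuation_on_nonneg[OF assms(4)] by simp
qed

text \<open>An optimal partition serves as the family of parts: for \<open>l = 1\<close> the minimum
  runs over single parts, so each is worth at least the share.\<close>

lemma has_parts_MMS: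
  assumes "finite Obj" "1 \<le> d" "valuation_on Obj v"
  shows "has_parts (\<lambda>x. v {x}) (MMS v 1 d Obj) d Obj"
proof -
  obtain P where P: "splits {1..d} P Obj" "MMS v 1 d Obj = min_union v 1 d P"
    using MMS_attained[OF assms(1,2)] by blast
  have sub: "P j \<subseteq> Obj" if "j \<in> {1..d}" for j using P(1) that by (auto simp: splits_def)
  have "MMS v 1 d Obj \<le> (\<Sum>x\<in>P j. v {x})" if "j \<in> {1..d}" for j
    using min_union_1_le[OF that, of v P] P(2) valuation_on_eq_sum[OF assms(3,1) sub[OF that]]
    by simp
  then show ?thesis unfolding has_parts_def
    using P(1) sub by (intro exI[of _ "{1..d}"] exI[of _ P]) (auto simp: splits_def)
qed

text \<open>Replies reveal a valuation only on subsets of \<open>Obj\<close>. This lets the share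
  computed from the replies stand for the true one.\<close>

lemma MMS_cong:
  assumes "\<And>S. S \<subseteq> Obj \<Longrightarrow> u S = v S"
  shows "MMS u l d Obj = MMS v l d Obj"
proof -
  have "min_union u l d P = min_union v l d P" if "splits {1..d} P Obj" for P
  proof -
    have "u (\<Union>j\<in>L. P j) = v (\<Union>j\<in>L. P j)" if "L \<subseteq> {1..d}" for L
      using that \<open>splits {1..d} P Obj\<close> by (intro assms) (auto simp: splits_def)
    then have "{u (\<Union>j\<in>L. P j) | L. L \<subseteq> {1..d} \<and> card L = l}
        = {v (\<Union>j\<in>L. P j) | L. L \<subseteq> {1..d} \<and> card L = l}" by metis
    then show ?thesis by (simp add: min_union_def)
  qed
  then have "{min_union u l d P | P. splits {1..d} P Obj}
      = {min_union v l d P | P. splits {1..d} P Obj}" by metis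
  then show ?thesis by (simp add: MMS_def)
qed

lemma valuation_on_cong:
  assumes "\<And>S. S \<subseteq> Obj \<Longrightarrow> u S = v S"
  shows "valuation_on Obj u \<longleftrightarrow> valuation_on Obj v"
  using assms by (simp add: valuation_on_def Measure_Space.additive_def)

lemma MMS_allocation_exists:
  fixes V :: "nat \<Rightarrow> 'a set \<Rightarrow> real"
  assumes "finite Obj" "n \<ge> 2" and V: "\<And>i. i \<in> {1..n} \<Longrightarrow> valuation_on Obj (V i)"
  shows "\<exists>Z. splits {1..n} Z Obj \<and> (\<forall>i\<in>{1..n}. V i (Z i) \<ge> MMS (V i) 1 (2 * n - 2) Obj)"
proof -
  define w where "w i x = V i {x}" for i x
  define t where "t i = MMS (V i) 1 (2 * n - 2) Obj" for i
  have d: "1 \<le> 2 * n - 2" using assms(2) by simp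
  have "\<exists>Z. allocation {1..n} Obj w t Z"
  proof (rule allocation_exists)
    show "{1..n} \<noteq> {}" using assms(2) by simp
    show "0 \<le> t i" if "i \<in> {1..n}" for i
      unfolding t_def using MMS_nonneg[OF assms(1) d d V[OF that]] .
    show "0 \<le> w i x" if "i \<in> {1..n}" "x \<in> Obj" for i x
      unfolding w_def using that valuation_on_nonneg[OF V] by simp
    show "has_parts (w i) (t i) (max 1 (2 * card {1..n} - 2)) Obj" if "i \<in> {1..n}" for i
      unfolding w_def t_def using has_parts_MMS[OF assms(1) d V[OF that]] d by (simp add: max_def)
  qed (use assms(1) in auto)
  then obtain Y where Y: "disjoint_family_on Y {1..n}"
    "\<And>i. i \<in> {1..n} \<Longrightarrow> Y i \<subseteq> Obj" "\<And>i. i \<in> {1..n} \<Longrightarrow> t i \<le> sum (w i) (Y i)"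
    unfolding allocation_def by blast
  \<comment> \<open>Agent 1 receives all leftovers, which makes the allocation a partition of
    \<open>Obj\<close>; nonnegativity ensures that no bundle loses value.\<close>
  define Z where "Z i = (if i = 1 then Y 1 \<union> (Obj - (\<Union>j\<in>{1..n}. Y j)) else Y i)" for i
  have one: "1 \<in> {1..n}" using assms(2) by simp
  have sub: "Y i \<subseteq> Z i" "Z i \<subseteq> Obj" if "i \<in> {1..n}" for i
    using Y(2) that one by (auto simp: Z_def)
  have "Z i \<inter> Z j = {}" if "i \<in> {1..n}" "j \<in> {1..n}" "i \<noteq> j" for i j
  proof -
    have "Y i \<inter> Y j = {}" using Y(1) that by (auto simp: disjoint_family_on_def)
    then show ?thesis using that unfolding Z_def by auto
  qed
  moreover have "(\<Union>i\<in>{1..n}. Z i) = Obj"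
  proof
    show "(\<Union>i\<in>{1..n}. Z i) \<subseteq> Obj" using sub by blast
    show "Obj \<subseteq> (\<Union>i\<in>{1..n}. Z i)"
    proof
      fix x assume "x \<in> Obj"
      then have "x \<in> (\<Union>i\<in>{1..n}. Y i) \<or> x \<in> Z 1" by (auto simp: Z_def)
      then show "x \<in> (\<Union>i\<in>{1..n}. Z i)" using sub one by blast
    qed
  qed
  ultimately have "splits {1..n} Z Obj" by (auto simp: splits_def disjoint_family_on_def)
  moreover have "MMS (V i) 1 (2 * n - 2) Obj \<le> V i (Z i)" if i: "i \<in> {1..n}" for i
  proof -
    have "t i \<le> sum (w i) (Y i)" using Y(3)[OF i] .
    also have "\<dots> \<le> sum (w i) (Z i)"
    proof (rule sum_mono2)
      show "finite (Z i)" using sub(2)[OF i] assms(1) finite_subset by blast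
      show "Y i \<subseteq> Z i" using sub(1)[OF i] .
      show "0 \<le> w i x" if "x \<in> Z i - Y i" for x
        unfolding w_def using that sub(2)[OF i] valuation_on_nonneg[OF V[OF i]] by blast
    qed
    also have "\<dots> = V i (Z i)"
      unfolding w_def using valuation_on_eq_sum[OF V[OF i] assms(1) sub(2)[OF i]] by simp
    finally show ?thesis by (simp add: t_def)
  qed
  ultimately show ?thesis by blast
qed

section \<open>The query protocol\<close>

text \<open>\<open>W\<close> is the record of replies so far, and \<open>F\<close> is an arbitrary
  rule that reads an allocation off the final record.\<close>

fun elicit :: "(nat \<times> 'a set) list \<Rightarrow> (nat \<Rightarrow> 'a set \<Rightarrow> real) \<Rightarrow>
    ((nat \<Rightarrow> 'a set \<Rightarrow> real) \<Rightarrow> nat \<Rightarrow> 'a set) \<Rightarrow> 'a protocol" where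
  "elicit [] W F = Allocate (F W)"
| "elicit ((i, S) # qs) W F = Ask i S (\<lambda>r. elicit qs (W(i := (W i)(S := r))) F)"

lemma protocol_for_elicit:
  "set qs \<subseteq> N \<times> Pow Obj \<Longrightarrow> protocol_for N Obj (elicit qs W F)"
  by (induction qs W F rule: elicit.induct) auto

lemma outcome_elicit:
  "outcome V (elicit qs W F) = F (\<lambda>i S. if (i, S) \<in> set qs then V i S else W i S)"
proof (induction qs W F rule: elicit.induct)
  case (2 i S qs W F)
  \<comment> \<open>The pair just asked moves from the record into the answered pairs; its value is
    \<open>V i S\<close> either way, even if it occurs again in \<open>qs\<close>.\<close>
  have "(\<lambda>j T. if (j, T) \<in> set qs then V j T else (W(i := (W i)(S := V i S))) j T)
      = (\<lambda>j T. if (j, T) \<in> set ((i, S) # qs) then V j T else W j T)"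
    by (auto simp: fun_eq_iff)
  then show ?case using 2[of "V i S"] by (simp only: elicit.simps outcome.simps)
qed simp

theorem theorem1p7:
  fixes Obj :: "'a set" and n :: nat
  assumes "finite Obj" and "n \<ge> 2"
  shows "\<exists>p. protocol_for {1..n} Obj p \<and>
    (\<forall>V :: nat \<Rightarrow> 'a set \<Rightarrow> real. (\<forall>i\<in>{1..n}. valuation_on Obj (V i)) \<longrightarrow>
      splits {1..n} (outcome V p) Obj \<and>
      (\<forall>i\<in>{1..n}. V i (outcome V p i) \<ge> MMS (V i) 1 (2 * n - 2) Obj))"
proof -
  define good where "good V Z \<longleftrightarrow> splits {1..n} Z Obj \<and>
    (\<forall>i\<in>{1..n}. V i (Z i) \<ge> MMS (V i) 1 (2 * n - 2) Obj)"
    for V :: "nat \<Rightarrow> 'a set \<Rightarrow> real" and Z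
  \<comment> \<open>The choice depends only on the valuations handed to \<open>F\<close>, which will
    be the recorded replies, so it can be built into a protocol fixed before
    \<open>V\<close>.\<close>
  define F where "F V = (SOME Z. good V Z)" for V
  have "finite ({1..n} \<times> Pow Obj)" using assms(1) by simp
  from finite_list[OF this] obtain qs where qs: "set qs = {1..n} \<times> Pow Obj" by (elim exE)
  define p where "p = elicit qs (\<lambda>_ _. 0) F"
  have "protocol_for {1..n} Obj p" using qs by (simp add: p_def protocol_for_elicit)
  moreover have "good V (outcome V p)"
    if V: "\<forall>i\<in>{1..n}. valuation_on Obj (V i)" for V
  proof -
    \<comment> \<open>The final record: truthful on all bundles of all agents, and the initial 0
      elsewhere. \<open>F\<close> finds an allocation that is good for \<open>W\<close>, and
      goodness carries over to \<open>V\<close> since both agree on subsets of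
      \<open>Obj\<close>.\<close>
    define W where "W i S = (if (i, S) \<in> set qs then V i S else 0)" for i S
    have out: "outcome V p = F W" by (simp add: p_def outcome_elicit W_def[abs_def])
    have W: "W i S = V i S" if "i \<in> {1..n}" "S \<subseteq> Obj" for i S
      using that by (simp add: W_def qs)
    have "valuation_on Obj (W i)" if "i \<in> {1..n}" for i
      using V that valuation_on_cong[of Obj "W i" "V i"] W by blast
    then have "\<exists>Z. good W Z"
      unfolding good_def using assms by (intro MMS_allocation_exists)
    then have F: "good W (F W)" unfolding F_def by (rule someI_ex)
    have "MMS (V i) 1 (2 * n - 2) Obj \<le> V i (F W i)" if i: "i \<in> {1..n}" for i
    proof -
      have "F W i \<subseteq> Obj" using F i by (auto simp: good_def splits_def)
      then have "W i (F W i) = V i (F W i)" by (rule W[OF i])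
      moreover have "MMS (W i) 1 (2 * n - 2) Obj = MMS (V i) 1 (2 * n - 2) Obj"
        by (rule MMS_cong) (rule W[OF i])
      moreover have "MMS (W i) 1 (2 * n - 2) Obj \<le> W i (F W i)"
        using F i unfolding good_def by blast
      ultimately show ?thesis by simp
    qed
    then show ?thesis using F by (simp add: out good_def)
  qed
  ultimately show ?thesis unfolding good_def by blast
qed

end
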